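(* Let $\mathbb F/\mathbb E$ be a field extension of finite degree, let $\ell,N$ be positive integers, let $\mathcal C_1\subseteq\mathbb F^\ell$ be a nonzero $\mathbb F$-linear code endowed with the Hamming metric and let $\mathcal C_2\subseteq\mathbb F^N$ be a nonzero $\mathbb F$-linear code endowed with the rank metric for $\mathbb F/\mathbb E$. Then $$\mathrm d_{\mathrm{srk}}(\mathcal C_1\otimes\mathcal C_2)=\mathrm d_{\mathrm H}(\mathcal C_1)\,\mathrm d_{\mathrm{rk}}(\mathcal C_2).$$
   Context: For $u=(u_0,\dots,u_{\ell-1})\in\mathbb F^\ell$ and $v\in\mathbb F^N$, $u\otimes v=(u_0v\mid u_1v\mid\dots\mid u_{\ell-1}v)\in\mathbb F^{\ell N}$, and $\mathcal C_1\otimes\mathcal C_2$ is the $\mathbb F$-span of $\{u\otimes v:u\in\mathcal C_1,v\in\mathcal C_2\}$. The rank weight of $v\in\mathbb F^N$ is $\mathrm{wt}_{\mathrm{rk}}(v)=\dim_{\mathbb E}\langle v_0,\dots,v_{N-1}\rangle_{\mathbb E}$. The sum-rank weight on $\mathbb F^{\ell N}$ with respect to the partition $(N,\dots,N)$ ($\ell$ times) is $\mathrm{wt}_{\mathrm{srk}}(c^{(0)}\mid\dots\mid c^{(\ell-1)})=\sum_{i=0}^{\ell-1}\mathrm{wt}_{\mathrm{rk}}(c^{(i)})$, with $c^{(i)}\in\mathbb F^N$. $\mathrm d_{\mathrm H},\mathrm d_{\mathrm{rk}},\mathrm d_{\mathrm{srk}}$ of a code denote the minimum of the Hamming, rank,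 sum-rank weight respectively over its nonzero codewords. *)

theory Defs
  imports
    "Jordan_Normal_Form.VS_Connect"
    "HOL-Algebra.Embedded_Algebras"
begin

text \<open>
  The large field is the type \<open>'f\<close>, viewed as the \<open>HOL-Algebra\<close> field \<open>class_ring\<close>; the small field
  is a subfield \<open>E\<close> of it. The space \<open>F^n\<close> is \<open>carrier_vec n\<close>, with coordinates indexed from 0.
\<close>

definition linear_code :: "nat \<Rightarrow> 'f::field vec set \<Rightarrow> bool" where
  "linear_code n C \<longleftrightarrow> VectorSpace.subspace class_ring C (module_vec TYPE('f) n)"

text \<open>Entry \<open>i * N + j\<close> is \<open>u $ i * v $ j\<close>, where \<open>N = dim_vec v\<close> and \<open>j < N\<close>, so that
  the \<open>i\<close>-th block of length \<open>N\<close> is \<open>u $ i \<cdot>\<^sub>v v\<close>.\<close>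

definition tensor_vec :: "'f::field vec \<Rightarrow> 'f vec \<Rightarrow> 'f vec" where
  "tensor_vec u v =
     vec (dim_vec u * dim_vec v) (\<lambda>k. u $ (k div dim_vec v) * v $ (k mod dim_vec v))"

definition tensor_code :: "nat \<Rightarrow> nat \<Rightarrow> 'f::field vec set \<Rightarrow> 'f vec set \<Rightarrow> 'f vec set" where
  "tensor_code l N C1 C2 =
     LinearCombinations.module.span class_ring (module_vec TYPE('f) (l * N))
       {tensor_vec u v | u v. u \<in> C1 \<and> v \<in> C2}"

definition hamming_weight :: "'f::field vec \<Rightarrow> nat" where
  "hamming_weight u = card {i. i < dim_vec u \<and> u $ i \<noteq> 0}"

definition rank_weight :: "'f::field set \<Rightarrow> 'f vec \<Rightarrow> nat" where
  "rank_weight E v = ring.dim class_ring E (ring.Span class_ring E (list_of_vec v))"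

definition vec_block :: "nat \<Rightarrow> nat \<Rightarrow> 'f vec \<Rightarrow> 'f vec" where
  "vec_block N i c = vec N (\<lambda>j. c $ (i * N + j))"

definition sum_rank_weight :: "'f::field set \<Rightarrow> nat \<Rightarrow> nat \<Rightarrow> 'f vec \<Rightarrow> nat" where
  "sum_rank_weight E l N c = (\<Sum>i<l. rank_weight E (vec_block N i c))"

text \<open>Unspecified if \<open>C\<close> has no nonzero codeword.\<close>

definition min_weight :: "('f::field vec \<Rightarrow> nat) \<Rightarrow> 'f vec set \<Rightarrow> nat" where
  "min_weight wt C = (LEAST w. \<exists>c\<in>C. c \<noteq> 0\<^sub>v (dim_vec c) \<and> w = wt c)"

definition hamming_distance :: "'f::field vec set \<Rightarrow> nat" where
  "hamming_distance C = min_weight hamming_weight C"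

definition rank_distance :: "'f::field set \<Rightarrow> 'f vec set \<Rightarrow> nat" where
  "rank_distance E C = min_weight (rank_weight E) C"

definition sum_rank_distance :: "'f::field set \<Rightarrow> nat \<Rightarrow> nat \<Rightarrow> 'f vec set \<Rightarrow> nat" where
  "sum_rank_distance E l N C = min_weight (sum_rank_weight E l N) C"

end

theory Submission
  imports Defs
begin

text \<open>
  Read a vector of length \<open>l * N\<close> as an \<open>l \<times> N\<close> matrix whose rows are its blocks. The codewords of
  \<open>C1 \<otimes> C2\<close> then have their rows in \<open>C2\<close> and their columns in \<open>C1\<close>. Each nonzero row has rank weight
  at least the rank distance of \<open>C2\<close>, and the support of any nonzero column, which has size at least
  the Hamming distance of \<open>C1\<close>, consists of indices of nonzero rows. Equality is attained by \<open>u \<otimes> v\<close>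
  for \<open>u\<close>, \<open>v\<close> of minimum weight, since scaling by a nonzero field element is an \<open>E\<close>-linear
  automorphism of the large field and hence preserves the rank weight.
\<close>

text \<open>Unfolds the module-theoretic subspace into closure conditions, the form in which the
  simplifier uses linearity from here on.\<close>

lemma linear_code_iff:
  fixes C :: "'f::field vec set"
  shows "linear_code n C \<longleftrightarrow>
    C \<subseteq> carrier_vec n \<and> 0\<^sub>v n \<in> C \<and> (\<forall>v\<in>C. \<forall>w\<in>C. v + w \<in> C) \<and> (\<forall>a. \<forall>v\<in>C. a \<cdot>\<^sub>v v \<in> C)"
  by (simp add: linear_code_def VectorSpace.subspace_def submodule_def vec_vs vec_module
      module_vec_simps Ball_def)
    blast

section \<open>Rows and columns of codewords of the tensor code\<close>

lemma tensor_vec_carrier: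
  "u \<in> carrier_vec l \<Longrightarrow> v \<in> carrier_vec N \<Longrightarrow> tensor_vec u v \<in> carrier_vec (l * N)"
  by (rule carrier_vecI) (simp add: tensor_vec_def)

lemma block_index_less:
  fixes i j l N :: nat
  assumes "i < l" "j < N"
  shows "i * N + j < l * N"
proof -
  have "i * N + j < Suc i * N"
    using assms(2) by simp
  also have "\<dots> \<le> l * N"
    using assms(1) by (intro mult_le_mono1) simp
  finally show ?thesis .
qed

lemma tensor_vec_index:
  assumes "u \<in> carrier_vec l" "v \<in> carrier_vec N" "i < l" "j < N"
  shows "tensor_vec u v $ (i * N + j) = u $ i * v $ j"
proof -
  have "(i * N + j) div N = i" "(i * N + j) mod N = j"
    using assms(4) by simp_all
  then show ?thesis
    using assms(1,2) block_index_less[OF assms(3,4)] by (simp add: tensor_vec_def)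
qed

lemma vec_block_tensor_vec:
  assumes "u \<in> carrier_vec l" "v \<in> carrier_vec N" "i < l"
  shows "vec_block N i (tensor_vec u v) = u $ i \<cdot>\<^sub>v v"
  using assms(2) tensor_vec_index[OF assms]
  by (intro eq_vecI) (simp_all add: vec_block_def)

definition vec_column :: "nat \<Rightarrow> nat \<Rightarrow> nat \<Rightarrow> 'f vec \<Rightarrow> 'f vec" where
  "vec_column l N j c = vec l (\<lambda>i. c $ (i * N + j))"

lemma vec_column_tensor_vec:
  assumes "u \<in> carrier_vec l" "v \<in> carrier_vec N" "j < N"
  shows "vec_column l N j (tensor_vec u v) = (v $ j :: 'f::field) \<cdot>\<^sub>v u"
  using assms(1) tensor_vec_index[OF assms(1,2) _ assms(3)]
  by (intro eq_vecI) (simp_all add: vec_column_def mult.commute)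

text \<open>Taking a row or a column is linear, so this set is an intersection of preimages of
  linear codes.\<close>

lemma linear_code_rows_columns:
  fixes C1 C2 :: "'f::field vec set"
  assumes C1: "linear_code l C1" and C2: "linear_code N C2"
  shows "linear_code (l * N) {c \<in> carrier_vec (l * N).
    (\<forall>i<l. vec_block N i c \<in> C2) \<and> (\<forall>j<N. vec_column l N j c \<in> C1)}" (is "linear_code _ ?M")
proof -
  have block_add: "vec_block N i (v + w) = vec_block N i v + vec_block N i w"
    if "v \<in> carrier_vec (l * N)" "w \<in> carrier_vec (l * N)" "i < l" for v w :: "'f vec" and i
    using that by (intro eq_vecI) (auto simp: vec_block_def block_index_less)
  have block_smult: "vec_block N i (a \<cdot>\<^sub>v v) = a \<cdot>\<^sub>v vec_block N i v"
    if "v \<in> carrier_vec (l * N)" "i < l" for a and v :: "'f vec" and i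
    using that by (intro eq_vecI) (auto simp: vec_block_def block_index_less)
  have block_zero: "vec_block N i (0\<^sub>v (l * N) :: 'f vec) = 0\<^sub>v N" if "i < l" for i
    using that by (intro eq_vecI) (auto simp: vec_block_def block_index_less)
  have column_add: "vec_column l N j (v + w) = vec_column l N j v + vec_column l N j w"
    if "v \<in> carrier_vec (l * N)" "w \<in> carrier_vec (l * N)" "j < N" for v w :: "'f vec" and j
    using that by (intro eq_vecI) (auto simp: vec_column_def block_index_less)
  have column_smult: "vec_column l N j (a \<cdot>\<^sub>v v) = a \<cdot>\<^sub>v vec_column l N j v"
    if "v \<in> carrier_vec (l * N)" "j < N" for a and v :: "'f vec" and j
    using that by (intro eq_vecI) (auto simp: vec_column_def block_index_less)
  have column_zero: "vec_column l N j (0\<^sub>v (l * N) :: 'f vec) = 0\<^sub>v l" if "j < N" for j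
    using that by (intro eq_vecI) (auto simp: vec_column_def block_index_less)
  show ?thesis
    using C1 C2
    by (simp add: linear_code_iff block_add block_smult block_zero
        column_add column_smult column_zero subset_iff)
qed

text \<open>Rows of \<open>tensor_vec u v\<close> are multiples of \<open>v\<close> and columns are
  multiples of \<open>u\<close>. So the generators lie in the subspace of the previous lemma, and
  hence so does their span.\<close>

lemma tensor_code_rows_columns:
  fixes C1 C2 :: "'f::field vec set"
  assumes C1: "linear_code l C1" and C2: "linear_code N C2"
    and c: "c \<in> tensor_code l N C1 C2"
  shows "c \<in> carrier_vec (l * N)"
    and "i < l \<Longrightarrow> vec_block N i c \<in> C2"
    and "j < N \<Longrightarrow> vec_column l N j c \<in> C1"
proof -
  let ?M = "{c \<in> carrier_vec (l * N).
    (\<forall>i<l. vec_block N i c \<in> C2) \<and> (\<forall>j<N. vec_column l N j c \<in> C1)}"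
  have "{tensor_vec u v | u v. u \<in> C1 \<and> v \<in> C2} \<subseteq> ?M"
  proof clarify
    fix u v assume uv: "u \<in> C1" "v \<in> C2"
    then have carrier: "u \<in> carrier_vec l" "v \<in> carrier_vec N"
      using C1 C2 by (auto simp: linear_code_iff)
    then show "tensor_vec u v \<in> carrier_vec (l * N) \<and>
      (\<forall>i<l. vec_block N i (tensor_vec u v) \<in> C2) \<and> (\<forall>j<N. vec_column l N j (tensor_vec u v) \<in> C1)"
      using uv C1 C2
      by (simp add: tensor_vec_carrier vec_block_tensor_vec vec_column_tensor_vec linear_code_iff)
  qed
  moreover have "submodule class_ring ?M (module_vec TYPE('f) (l * N))"
    using linear_code_rows_columns[OF C1 C2]
    unfolding linear_code_def VectorSpace.subspace_def by blast
  ultimately have "tensor_code l N C1 C2 \<subseteq> ?M"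
    unfolding tensor_code_def by (rule module.span_is_subset[OF vec_module])
  with c show "c \<in> carrier_vec (l * N)" "i < l \<Longrightarrow> vec_block N i c \<in> C2"
    "j < N \<Longrightarrow> vec_column l N j c \<in> C1"
    by auto
qed

lemma tensor_vec_in_tensor_code:
  fixes C1 C2 :: "'f::field vec set"
  assumes "linear_code l C1" "linear_code N C2" "u \<in> C1" "v \<in> C2"
  shows "tensor_vec u v \<in> tensor_code l N C1 C2"
proof -
  have "{tensor_vec u v | u v. u \<in> C1 \<and> v \<in> C2} \<subseteq> carrier (module_vec TYPE('f) (l * N))"
    using assms(1,2) by (auto simp: module_vec_simps linear_code_iff intro!: tensor_vec_carrier)
  from module.in_own_span[OF vec_module this] show ?thesis
    unfolding tensor_code_def using assms(3,4) by blast
qed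

section \<open>Invariance of the rank weight under scaling\<close>

lemma line_extension_class_ring:
  fixes K :: "'f::ring_1 set"
  shows "ring.line_extension class_ring K a V = {k * a + v | k v. k \<in> K \<and> v \<in> V}"
  by (rule Set.set_eqI) (simp add: ring.line_extension_mem_iff[OF class_ring.ring_axioms], blast)

lemma line_extension_scale:
  fixes a :: "'f::field"
  shows "(*) a ` ring.line_extension class_ring K b V
    = ring.line_extension class_ring K (a * b) ((*) a ` V)"
proof -
  have "(*) a ` {k * b + v | k v. k \<in> K \<and> v \<in> V} = {a * (k * b + v) | k v. k \<in> K \<and> v \<in> V}"
    by blast
  also have "\<dots> = {k * (a * b) + a * v | k v. k \<in> K \<and> v \<in> V}"
    by (simp add: algebra_simps)
  also have "\<dots> = {k * (a * b) + w | k w. k \<in> K \<and> w \<in> (*) a ` V}"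
    by blast
  finally show ?thesis
    unfolding line_extension_class_ring .
qed

text \<open>\<open>Span\<close> is an iterated line extension starting from \<open>{0}\<close>, and
  multiplication by \<open>a\<close> commutes with each extension.\<close>

lemma Span_scale:
  fixes a :: "'f::field"
  shows "ring.Span class_ring K (map ((*) a) Us) = (*) a ` ring.Span class_ring K Us"
  by (induction Us)
    (simp_all add: ring.Span.simps[OF class_ring.ring_axioms] line_extension_scale)

lemma dimension_scale:
  fixes a :: "'f::field"
  assumes "ring.dimension class_ring n K V" and "a \<noteq> 0"
  shows "ring.dimension class_ring n K ((*) a ` V)"
  using assms(1)
proof (induction rule: ring.dimension.induct[OF class_ring.ring_axioms, consumes 1])
  case (1 K)
  show ?case
    using ring.zero_dim[OF class_ring.ring_axioms, of K] by simp
next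
  case (2 v V n K)
  \<comment> \<open>Multiplication by a nonzero \<open>a\<close> is injective, so the new basis
    vector stays outside the scaled space.\<close>
  have "a * v \<notin> (*) a ` V"
    using 2 \<open>a \<noteq> 0\<close> by auto
  then show ?case
    using ring.Suc_dim[OF class_ring.ring_axioms, of "a * v" "(*) a ` V" n K] 2
    by (simp add: line_extension_scale)
qed

text \<open>Scaling by \<open>a\<close> and back by \<open>inverse a\<close> shows that both sets
  satisfy \<open>dimension n K\<close> for the same \<open>n\<close>. As \<open>dim\<close> is
  defined from that predicate, the existence of a dimension need not be shown.\<close>

lemma dim_scale:
  fixes a :: "'f::field"
  assumes "a \<noteq> 0"
  shows "ring.dim class_ring K ((*) a ` V) = ring.dim class_ring K V"
proof -
  have "(*) (inverse a) ` (*) a ` V = V"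
    using assms by (simp add: image_image mult.assoc[symmetric])
  then have "ring.dimension class_ring n K ((*) a ` V) \<longleftrightarrow> ring.dimension class_ring n K V" for n
    using dimension_scale[of n K V a] dimension_scale[of n K "(*) a ` V" "inverse a"] assms
    by auto
  then show ?thesis
    by (simp add: ring.dim_def[OF class_ring.ring_axioms])
qed

lemma rank_weight_smult:
  assumes "a \<noteq> 0"
  shows "rank_weight E (a \<cdot>\<^sub>v v) = rank_weight E v"
proof -
  have "list_of_vec (a \<cdot>\<^sub>v v) = map ((*) a) (list_of_vec v)"
    by (rule nth_equalityI) (auto simp: list_of_vec_index)
  then show ?thesis
    unfolding rank_weight_def by (simp add: Span_scale dim_scale[OF assms])
qed

lemma rank_weight_zero:
  fixes E :: "'f::field set"
  assumes "subfield E class_ring"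
  shows "rank_weight E (0\<^sub>v N) = 0"
proof -
  have "0 \<in> E"
    using ring.subring_props(2)[OF class_ring.ring_axioms assms] by simp
  \<comment> \<open>The elements are \<open>k * 0 + 0\<close> with \<open>k\<close> in
    \<open>E\<close>; membership of 0 in \<open>E\<close> ensures that there is one.\<close>
  then have "ring.line_extension class_ring E 0 {0} = {0}"
    by (auto simp: line_extension_class_ring)
  then have "ring.Span class_ring E (replicate N 0) = {0}"
    by (induction N) (simp_all add: ring.Span.simps[OF class_ring.ring_axioms])
  moreover have "list_of_vec (0\<^sub>v N :: 'f vec) = replicate N 0"
    by (rule nth_equalityI) (auto simp: list_of_vec_index)
  moreover have "ring.dim class_ring E {0} = 0"
    using ring.dimI[OF class_ring.ring_axioms assms, of 0 "{0}"]
      ring.zero_dim[OF class_ring.ring_axioms, of E]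
    by (simp add: over_def)
  ultimately show ?thesis
    by (simp add: rank_weight_def)
qed

section \<open>Minimum weights and nonzero codewords\<close>

lemma min_weight_le:
  assumes "c \<in> C" "c \<noteq> 0\<^sub>v (dim_vec c)"
  shows "min_weight wt C \<le> wt c"
  unfolding min_weight_def using assms by (intro Least_le) blast

text \<open>The codeword \<open>c\<close> only ensures that the \<open>LEAST\<close> ranges over a
  nonempty set; the minimizer \<open>d\<close> may be a different one.\<close>

lemma min_weight_attained:
  assumes "c \<in> C" "c \<noteq> 0\<^sub>v (dim_vec c)"
  obtains d where "d \<in> C" "d \<noteq> 0\<^sub>v (dim_vec d)" "wt d = min_weight wt C"
proof -
  have "\<exists>d\<in>C. d \<noteq> 0\<^sub>v (dim_vec d) \<and> min_weight wt C = wt d"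
    unfolding min_weight_def
    by (rule LeastI[of "\<lambda>w. \<exists>d\<in>C. d \<noteq> 0\<^sub>v (dim_vec d) \<and> w = wt d" "wt c"]) (use assms in blast)
  then show ?thesis
    using that by auto
qed

lemma min_weight_eqI:
  assumes "c \<in> C" "c \<noteq> 0\<^sub>v (dim_vec c)"
    and "\<And>d. d \<in> C \<Longrightarrow> d \<noteq> 0\<^sub>v (dim_vec d) \<Longrightarrow> wt c \<le> wt d"
  shows "min_weight wt C = wt c"
  unfolding min_weight_def using assms by (intro Least_equality) auto

lemma nonzero_codeword_exists:
  assumes "linear_code n C" "C \<noteq> {0\<^sub>v n}"
  obtains c where "c \<in> C" "c \<noteq> 0\<^sub>v (dim_vec c)"
proof -
  obtain c where "c \<in> C" "c \<noteq> 0\<^sub>v n"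
    using assms by (auto simp: linear_code_iff)
  moreover have "dim_vec c = n"
    using assms(1) \<open>c \<in> C\<close> by (auto simp: linear_code_iff)
  ultimately show ?thesis
    using that by blast
qed

lemma vec_nonzero_iff: "c \<noteq> 0\<^sub>v (dim_vec c) \<longleftrightarrow> (\<exists>i<dim_vec c. c $ i \<noteq> 0)"
  by (auto simp: vec_eq_iff)

section \<open>Sum-rank weights of elementary tensors and of arbitrary codewords\<close>

lemma tensor_vec_nonzero:
  assumes "u \<noteq> 0\<^sub>v (dim_vec u)" "v \<noteq> 0\<^sub>v (dim_vec v)"
  shows "tensor_vec u v \<noteq> 0\<^sub>v (dim_vec (tensor_vec u v))"
proof -
  obtain i j where "i < dim_vec u" "u $ i \<noteq> 0" "j < dim_vec v" "v $ j \<noteq> 0"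
    using assms unfolding vec_nonzero_iff by blast
  moreover from this have "tensor_vec u v $ (i * dim_vec v + j) \<noteq> 0"
    by (subst tensor_vec_index[of u "dim_vec u"]) auto
  ultimately show ?thesis
    unfolding vec_nonzero_iff by (auto simp: tensor_vec_def intro!: block_index_less)
qed

text \<open>Block \<open>i\<close> is \<open>u $ i\<close> times \<open>v\<close>: it contributes
  the full rank weight of \<open>v\<close> if \<open>i\<close> is in the support of
  \<open>u\<close>, and nothing otherwise.\<close>

lemma sum_rank_weight_tensor_vec:
  fixes u v :: "'f::field vec"
  assumes "subfield E class_ring" and u: "u \<in> carrier_vec l" and v: "v \<in> carrier_vec N"
  shows "sum_rank_weight E l N (tensor_vec u v) = hamming_weight u * rank_weight E v"
proof -
  have "0 \<cdot>\<^sub>v v = 0\<^sub>v N"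
    using v by (intro eq_vecI) auto
  then have "rank_weight E (vec_block N i (tensor_vec u v)) = (if u $ i \<noteq> 0 then rank_weight E v else 0)"
    if "i < l" for i
    using that by (simp add: vec_block_tensor_vec[OF u v] rank_weight_smult rank_weight_zero[OF assms(1)])
  then have "sum_rank_weight E l N (tensor_vec u v)
    = (\<Sum>i<l. if u $ i \<noteq> 0 then rank_weight E v else 0)"
    unfolding sum_rank_weight_def by (intro sum.cong) auto
  also have "\<dots> = (\<Sum>i\<in>{i. i < l \<and> u $ i \<noteq> 0}. rank_weight E v)"
    by (intro sum.mono_neutral_cong_right) auto
  also have "\<dots> = hamming_weight u * rank_weight E v"
    using u by (simp add: hamming_weight_def)
  finally show ?thesis .
qed

lemma sum_rank_weight_lower_bound:
  fixes C1 C2 :: "'f::field vec set"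
  assumes C1: "linear_code l C1" and C2: "linear_code N C2"
    and c: "c \<in> tensor_code l N C1 C2" "c \<noteq> 0\<^sub>v (dim_vec c)"
  shows "hamming_distance C1 * rank_distance E C2 \<le> sum_rank_weight E l N c"
proof -
  note rc = tensor_code_rows_columns[OF C1 C2 c(1)]
  obtain k where k: "k < l * N" "c $ k \<noteq> 0"
    using c(2) rc(1) unfolding vec_nonzero_iff by auto
  \<comment> \<open>The nonzero entry \<open>k\<close> sits in row \<open>k div N\<close> and column
    \<open>j\<close>, so column \<open>j\<close> is a nonzero codeword of \<open>C1\<close>.\<close>
  define j where "j = k mod N"
  have "0 < N"
    using k(1) by (cases N) auto
  then have j: "j < N" and i: "k div N < l"
    using k(1) by (auto simp: j_def less_mult_imp_div_less)
  define w where "w = vec_column l N j c"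
  let ?S = "{i. i < l \<and> w $ i \<noteq> 0}"
  have "w $ (k div N) \<noteq> 0"
    using k(2) i by (simp add: w_def vec_column_def j_def)
  then have "w \<noteq> 0\<^sub>v (dim_vec w)"
    unfolding vec_nonzero_iff using i by (auto simp: w_def vec_column_def)
  then have "hamming_distance C1 \<le> hamming_weight w"
    unfolding hamming_distance_def w_def by (intro min_weight_le rc(3) j)
  also have "hamming_weight w = card ?S"
    by (simp add: hamming_weight_def w_def vec_column_def)
  finally have "hamming_distance C1 * rank_distance E C2 \<le> (\<Sum>i\<in>?S. rank_distance E C2)"
    by simp
  also have "\<dots> \<le> (\<Sum>i\<in>?S. rank_weight E (vec_block N i c))"
  proof (rule sum_mono)
    \<comment> \<open>Entry \<open>j\<close> of row \<open>i\<close> is entry \<open>i\<close> of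
      column \<open>w\<close>, so every index in the support of \<open>w\<close> gives a nonzero
      row.\<close>
    fix i assume "i \<in> ?S"
    then have "i < l" "vec_block N i c $ j \<noteq> 0"
      using j by (auto simp: w_def vec_column_def vec_block_def)
    moreover have "j < dim_vec (vec_block N i c)"
      using j by (simp add: vec_block_def)
    ultimately show "rank_distance E C2 \<le> rank_weight E (vec_block N i c)"
      unfolding rank_distance_def by (intro min_weight_le rc(2)) (auto simp: vec_nonzero_iff)
  qed
  \<comment> \<open>Rows outside the support of \<open>w\<close> may be nonzero, but they can only
    add to the sum.\<close>
  also have "\<dots> \<le> sum_rank_weight E l N c"
    unfolding sum_rank_weight_def by (intro sum_mono2) auto
  finally show ?thesis .
qed

theorem proposition5p3:
  fixes E :: "'f::field set" and l N :: nat and C1 C2 :: "'f vec set"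
  assumes "subfield E class_ring"
    and "ring.finite_dimension class_ring E (carrier class_ring)"
    and "0 < l" and "0 < N"
    and "linear_code l C1" and "C1 \<noteq> {0\<^sub>v l}"
    and "linear_code N C2" and "C2 \<noteq> {0\<^sub>v N}"
  shows "sum_rank_distance E l N (tensor_code l N C1 C2)
         = hamming_distance C1 * rank_distance E C2"
proof -
  obtain u where u: "u \<in> C1" "u \<noteq> 0\<^sub>v (dim_vec u)" "hamming_weight u = hamming_distance C1"
    unfolding hamming_distance_def
    by (rule nonzero_codeword_exists[OF assms(5,6)]) (erule (1) min_weight_attained)
  obtain v where v: "v \<in> C2" "v \<noteq> 0\<^sub>v (dim_vec v)" "rank_weight E v = rank_distance E C2"
    unfolding rank_distance_def
    by (rule nonzero_codeword_exists[OF assms(7,8)]) (erule (1) min_weight_attained)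
  have "u \<in> carrier_vec l" "v \<in> carrier_vec N"
    using u v assms(5,7) by (auto simp: linear_code_iff)
  then have wt: "sum_rank_weight E l N (tensor_vec u v) = hamming_distance C1 * rank_distance E C2"
    by (simp add: sum_rank_weight_tensor_vec[OF assms(1)] u(3) v(3))
  \<comment> \<open>The tensor of two minimizers is a nonzero codeword whose weight equals the lower
    bound, so it attains the minimum.\<close>
  have "sum_rank_distance E l N (tensor_code l N C1 C2) = sum_rank_weight E l N (tensor_vec u v)"
    unfolding sum_rank_distance_def
    using u v assms(5,7)
    by (intro min_weight_eqI)
      (simp_all add: tensor_vec_in_tensor_code tensor_vec_nonzero wt sum_rank_weight_lower_bound)
  with wt show ?thesis
    by simp
qed

end
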